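(* Let $g:\mathbb{R}^m\to\mathbb{R}$ be a convex Fréchet differentiable function with $L_g$-Lipschitz continuous gradient, and assume that $\operatorname{argmin} g\neq\emptyset$. Let $t_0>0$, $u_0,v_0\in\mathbb{R}^m$, $\alpha>3$, $\gamma>0$ and $\beta\in\mathbb{R}$. Let $x:[t_0,+\infty)\to\mathbb{R}^m$ be the unique strong global solution of the dynamical system $$\ddot{x}(t)+\frac{\alpha}{t}\dot{x}(t)+\nabla g\left(x(t)+\left(\gamma+\frac{\beta}{t}\right)\dot{x}(t)\right)=0,\qquad x(t_0)=u_0,\ \dot{x}(t_0)=v_0.$$ Then $x(t)$ converges to a point in $\operatorname{argmin} g$ as $t\to+\infty$.
   Context: $\mathbb{R}^m$ carries the Euclidean norm $\|\cdot\|$. That $\nabla g$ is $L_g$-Lipschitz means $L_g\ge 0$ and $\|\nabla g(x)-\nabla g(y)\|\le L_g\|x-y\|$ for all $x,y\in\mathbb{R}^m$. A function $x:[t_0,+\infty)\to\mathbb{R}^m$ is a strong global solution of the dynamical system if: (i) $x$ and $\dot x$ are locally absolutely continuous on $[t_0,+\infty)$ (i.e. absolutely continuous on every compact interval $[t_0,T]$, $T>t_0$); (ii) the differential equation holds for almost every $t\ge t_0$; (iii) $x(t_0)=u_0$ and $\dot x(t_0)=v_0$. Under the stated assumptions such a solution exists and is unique. *)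

theory Defs
  imports "HOL-Analysis.Analysis"
begin

text \<open>
  The usual epsilon-delta notion, for finite families of non-overlapping compact intervals in
  \<open>S\<close>. A member of a division in \<^typ>\<open>real\<close> is a nonempty interval \<open>{c..d}\<close>, so its
  \<^const>\<open>Inf\<close> and \<^const>\<open>Sup\<close> are its end points; degenerate intervals contribute 0 to both sums.
\<close>

definition absolutely_continuous_on :: "real set \<Rightarrow> (real \<Rightarrow> 'a::real_normed_vector) \<Rightarrow> bool"
  where "absolutely_continuous_on S f \<longleftrightarrow>
    (\<forall>\<epsilon>>0. \<exists>\<delta>>0. \<forall>D T. D division_of T \<and> T \<subseteq> S \<and> (\<Sum>K\<in>D. measure lborel K) < \<delta> \<longrightarrow>
       (\<Sum>K\<in>D. norm (f (Sup K) - f (Inf K))) < \<epsilon>)"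

definition locally_absolutely_continuous_from ::
    "real \<Rightarrow> (real \<Rightarrow> 'a::real_normed_vector) \<Rightarrow> bool"
  where "locally_absolutely_continuous_from t0 f \<longleftrightarrow>
    (\<forall>T>t0. absolutely_continuous_on {t0..T} f)"

text \<open>
  Only the values of \<open>x\<close> on \<open>{t0..}\<close> matter: derivatives are taken within that set, hence are
  one-sided at \<open>t0\<close>. The velocity \<open>x'\<close> is absolutely continuous and so is required at every
  \<open>t \<ge> t0\<close>, while the acceleration \<open>x''\<close> need only exist almost everywhere.
  The argument \<open>G\<close> is the gradient field of the objective function.
\<close>

definition strong_global_solution ::
    "('a::euclidean_space \<Rightarrow> 'a) \<Rightarrow> real \<Rightarrow> real \<Rightarrow> real \<Rightarrow> real \<Rightarrow> 'a \<Rightarrow> 'a \<Rightarrow> (real \<Rightarrow> 'a) \<Rightarrow> bool"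
  where "strong_global_solution G \<alpha> \<beta> \<gamma> t0 u0 v0 x \<longleftrightarrow>
    (\<exists>x' x''.
       (\<forall>t\<ge>t0. (x has_vector_derivative x' t) (at t within {t0..})) \<and>
       (AE t in lebesgue. t0 \<le> t \<longrightarrow> (x' has_vector_derivative x'' t) (at t within {t0..})) \<and>
       locally_absolutely_continuous_from t0 x \<and>
       locally_absolutely_continuous_from t0 x' \<and>
       (AE t in lebesgue. t0 \<le> t \<longrightarrow>
          x'' t + (\<alpha> / t) *\<^sub>R x' t + G (x t + (\<gamma> + \<beta> / t) *\<^sub>R x' t) = 0) \<and>
       x t0 = u0 \<and> x' t0 = v0)"

abbreviation argmin :: "('a \<Rightarrow> 'b::linorder) \<Rightarrow> 'a set"
  where "argmin g \<equiv> {y. is_arg_min g (\<lambda>_. True) y}"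

end

theory Submission
  imports Defs "HOL-Real_Asymp.Real_Asymp"
begin

text \<open>
  An absolutely continuous function is the integral of its almost everywhere derivative, so the
  velocity \<open>v\<close> of a strong solution is continuously differentiable and the equation
  holds classically. Put \<open>y(t) = x(t) + (\<gamma> + \<beta>/t) v(t)\<close>. For
  \<open>p \<in> argmin g\<close> and every \<open>b\<close> with \<open>2 < b < \<alpha> - 1\<close> the energy
  \<open>t\<^sup>2 (g(y) - g(p)) + \<parallel>b (x - p) + t v\<parallel>\<^sup>2/2 + b (\<alpha> - 1 - b) \<parallel>x - p\<parallel>\<^sup>2/2\<close>
  is nonnegative and eventually nonincreasing: the mixed term \<open>\<langle>v, \<nabla>g(y)\<rangle>\<close>
  in its derivative has a coefficient of order \<open>t\<close> and is absorbed by
  \<open>- \<gamma> t\<^sup>2 \<parallel>\<nabla>g(y)\<parallel>\<^sup>2\<close> and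
  \<open>- (\<alpha> - 1 - b) t \<parallel>v\<parallel>\<^sup>2\<close>. Hence \<open>g(y) \<rightarrow> g(p)\<close> and
  \<open>v \<rightarrow> 0\<close>. The energies for two values of \<open>b\<close> differ by a multiple of
  \<open>(\<alpha> - 1) h + t h'\<close> with \<open>h = \<parallel>x - p\<parallel>\<^sup>2/2\<close>, so this
  expression converges, and therefore so does \<open>h\<close>. A cluster point of \<open>x\<close> is a
  minimiser, and taking it for \<open>p\<close> gives \<open>h \<rightarrow> 0\<close> (Opial's argument).
\<close>

section \<open>Absolute continuity and the gauge integral\<close>

text \<open>The gauge treats two kinds of tags separately. Outside \<open>N\<close>,
  differentiability makes the error on an interval at most a small multiple of its length. Tags in
  \<open>N\<close> are confined to an open set of small measure, where absolute continuity bounds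
  the sum of the increments of \<open>f\<close>.\<close>

lemma fundamental_theorem_of_calculus_absolutely_continuous:
  fixes f :: "real \<Rightarrow> 'a::banach"
  assumes "a \<le> b" and ac: "absolutely_continuous_on {a..b} f" and N: "negligible N"
    and deriv: "\<And>t. t \<in> {a..b} - N \<Longrightarrow> (f has_vector_derivative f' t) (at t within {a..b})"
  shows "(f' has_integral (f b - f a)) {a..b}"
proof -
  \<comment> \<open>With the value 0 on \<open>N\<close>, an interval tagged there contributes only
    an increment of \<open>f\<close>.\<close>
  define \<phi> where "\<phi> t = (if t \<in> N then 0 else f' t)" for t
  have "(\<phi> has_integral (f b - f a)) (cbox a b)"
    unfolding has_integral
  proof (intro allI impI)
    fix e :: real assume e: "e > 0"
    \<comment> \<open>Half of \<open>e\<close> is reserved for the good tags. The summand 1 keeps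
      the denominator positive when \<open>a = b\<close>.\<close>
    define e' where "e' = e / (2 * (b - a + 1))"
    have e': "e' > 0" "e' * (b - a) < e / 2"
      using e \<open>a \<le> b\<close> by (auto simp: e'_def field_simps)
    obtain \<delta> where \<delta>: "\<delta> > 0" and
      small: "\<And>D T. D division_of T \<Longrightarrow> T \<subseteq> {a..b} \<Longrightarrow> (\<Sum>K\<in>D. measure lborel K) < \<delta> \<Longrightarrow>
        (\<Sum>K\<in>D. norm (f (Sup K) - f (Inf K))) < e / 2"
      using ac e unfolding absolutely_continuous_on_def by (meson half_gt_zero)
    obtain U where U: "open U" "N \<subseteq> U" "U \<in> lmeasurable" "measure lebesgue U < \<delta>"
    proof -
      have "N \<in> null_sets lebesgue" using N negligible_iff_null_sets by blast
      then obtain U where U: "open U" "N \<subseteq> U" "(U - N) \<in> lmeasurable"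
          "emeasure lebesgue (U - N) < ennreal \<delta>"
        using sets_lebesgue_outer_open[OF _ \<delta>] null_setsD2 by metis
      have "N \<in> lmeasurable" using N negligible_iff_measure by blast
      then have "U \<in> lmeasurable"
        using U fmeasurable.Un[of "U - N" lebesgue N] by (simp add: Un_absorb2)
      moreover have "emeasure lebesgue (U - N) = emeasure lebesgue U"
        using \<open>N \<in> null_sets lebesgue\<close> U(1)
        by (intro emeasure_Diff_null_set) auto
      ultimately show thesis
        using that U \<delta> by (simp add: emeasure_eq_measure2 ennreal_less_iff)
    qed
    \<comment> \<open>If \<open>t\<close> lies neither in \<open>N\<close> nor in
      \<open>{a..b}\<close>, both conditions are vacuous and any radius serves.\<close>
    have "\<exists>r>0. (t \<in> N \<longrightarrow> ball t r \<subseteq> U) \<and> (t \<in> {a..b} - N \<longrightarrow>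
        (\<forall>s\<in>{a..b}. norm (s - t) < r \<longrightarrow>
          norm (f s - f t - (s - t) *\<^sub>R f' t) \<le> e' * norm (s - t)))" for t
      using deriv[of t] U e' open_contains_ball[of U]
      unfolding has_vector_derivative_def has_derivative_within_alt
      by (cases "t \<in> N"; cases "t \<in> {a..b}") (auto intro: zero_less_one)
    then obtain r where r: "\<And>t. r t > 0" "\<And>t. t \<in> N \<Longrightarrow> ball t (r t) \<subseteq> U"
      "\<And>s t. t \<in> {a..b} - N \<Longrightarrow> s \<in> {a..b} \<Longrightarrow> norm (s - t) < r t \<Longrightarrow>
          norm (f s - f t - (s - t) *\<^sub>R f' t) \<le> e' * norm (s - t)"
      by metis
    show "\<exists>\<gamma>. gauge \<gamma> \<and> (\<forall>p. p tagged_division_of cbox a b \<and> \<gamma> fine p \<longrightarrow>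
        norm ((\<Sum>(t, K)\<in>p. measure lborel K *\<^sub>R \<phi> t) - (f b - f a)) < e)"
    proof (intro exI conjI allI impI; (elim conjE)?)
      show "gauge (\<lambda>t. ball t (r t))" using r(1) by (simp add: gauge_ball_dependent)
      fix p assume p: "p tagged_division_of cbox a b" and fine: "(\<lambda>t. ball t (r t)) fine p"
      define q where "q = {z \<in> p. fst z \<in> N}"
      have fin: "finite p" "finite q" using p by (auto simp: q_def)
      have q: "q tagged_partial_division_of cbox a b"
        using p tagged_partial_division_subset[of p "cbox a b" q]
        by (auto simp: q_def tagged_division_of_def)
      have qU: "K \<subseteq> U" "K \<subseteq> {a..b}" "\<exists>u v. K = {u..v} \<and> u \<le> v" if tK: "(t, K) \<in> q" for t K
      proof -
        have "t \<in> N" "(t, K) \<in> p" using tK by (auto simp: q_def)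
        then show "K \<subseteq> U" using fine r(2) by blast
        show "K \<subseteq> {a..b}" using p \<open>(t, K) \<in> p\<close> by auto
        obtain u v where "K = {u..v}" "t \<in> K"
          using p \<open>(t, K) \<in> p\<close> by (metis box_real(2) tagged_division_ofD(2,4))
        then show "\<exists>u v. K = {u..v} \<and> u \<le> v" by auto
      qed
      have bad: "(\<Sum>(t, K)\<in>q. norm (f (Sup K) - f (Inf K))) < e / 2"
      proof -
        have div: "snd ` q division_of \<Union>(snd ` q)"
          using q by (rule partial_division_of_tagged_division)
        have "(\<Sum>K\<in>snd ` q. measure lborel K) = (\<Sum>K\<in>snd ` q. measure lebesgue K)"
          using qU(3) by (intro sum.cong) force+
        also have "\<dots> = measure lebesgue (\<Union>(snd ` q))"
          using content_division[OF div] by simp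
        also have "\<dots> \<le> measure lebesgue U"
        proof (rule measure_mono_fmeasurable)
          show "\<Union>(snd ` q) \<subseteq> U" using qU(1) by force
          show "\<Union>(snd ` q) \<in> sets lebesgue"
            using lmeasurable_division[OF div] by blast
        qed (use U in auto)
        finally have "(\<Sum>K\<in>snd ` q. measure lborel K) < \<delta>" using U by linarith
        then have "(\<Sum>K\<in>snd ` q. norm (f (Sup K) - f (Inf K))) < e / 2"
          using small[OF div] qU(2) by force
        \<comment> \<open>Distinct tags share an interval only if it is degenerate, and then the
          increment over it is 0.\<close>
        moreover have "(\<Sum>(t, K)\<in>q. norm (f (Sup K) - f (Inf K)))
            = (\<Sum>K\<in>snd ` q. norm (f (Sup K) - f (Inf K)))"
        proof -
          \<comment> \<open>the case distinction is needed as \<open>Sup {}\<close> and \<open>Inf {}\<close> are unspecified reals\<close>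
          define \<nu> where "\<nu> K = (if K = {} then 0 else norm (f (Sup K) - f (Inf K)))" for K
          have "(\<Sum>(t, K)\<in>q. norm (f (Sup K) - f (Inf K))) = (\<Sum>(t, K)\<in>q. \<nu> K)"
            using qU(3) by (intro sum.cong) (force simp: \<nu>_def)+
          also have "\<dots> = (\<Sum>K\<in>snd ` q. \<nu> K)"
          proof (rule sum.over_tagged_division_lemma)
            show "q tagged_division_of \<Union>(snd ` q)"
              using q by (rule tagged_partial_division_of_Union_self)
            show "\<nu> (cbox u v) = 0" if "box u v = {}" for u v :: real
              using that by (cases "u = v") (auto simp: \<nu>_def)
          qed
          also have "\<dots> = (\<Sum>K\<in>snd ` q. norm (f (Sup K) - f (Inf K)))"
            using qU(3) by (intro sum.cong) (force simp: \<nu>_def)+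
          finally show ?thesis .
        qed
        ultimately show ?thesis by simp
      qed
      have "norm ((\<Sum>(t, K)\<in>p. measure lborel K *\<^sub>R \<phi> t) - (f b - f a))
          = norm (\<Sum>(t, K)\<in>p. measure lborel K *\<^sub>R \<phi> t - (f (Sup K) - f (Inf K)))"
        using additive_tagged_division_1[OF \<open>a \<le> b\<close>, of p f] p
        by (simp add: sum_subtractf case_prod_unfold)
      also have "\<dots> \<le> (\<Sum>(t, K)\<in>p. e' * measure lborel K
          + (if t \<in> N then norm (f (Sup K) - f (Inf K)) else 0))"
      proof (rule sum_norm_le, safe)
        fix t K assume tK: "(t, K) \<in> p"
        obtain u v where K: "K = {u..v}" "t \<in> K"
          using p tK by (metis box_real(2) tagged_division_ofD(2,4))
        then have "u \<in> K" "v \<in> K" by auto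
        moreover have "K \<subseteq> {a..b}" "K \<subseteq> ball t (r t)" using p tK fine by auto
        ultimately have "u \<in> {a..b}" "v \<in> {a..b}" "u \<in> ball t (r t)" "v \<in> ball t (r t)"
          by blast+
        then have uv: "u \<in> {a..b}" "v \<in> {a..b}" "t \<in> {a..b}" "u \<le> t" "t \<le> v"
            "norm (u - t) < r t" "norm (v - t) < r t"
          using K by (auto simp: dist_real_def)
        show "norm (measure lborel K *\<^sub>R \<phi> t - (f (Sup K) - f (Inf K))) \<le> e' * measure lborel K
            + (if t \<in> N then norm (f (Sup K) - f (Inf K)) else 0)"
        proof (cases "t \<in> N")
          case True
          then show ?thesis using e' by (simp add: \<phi>_def norm_minus_commute)
        next
          case False
          \<comment> \<open>Straddling: the tag lies between the end points \<open>u\<close> and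
            \<open>v\<close>, so the two one-sided errors add up to a multiple of the full length
            \<open>v - u\<close>.\<close>
          have "measure lborel K *\<^sub>R \<phi> t - (f (Sup K) - f (Inf K))
              = (f u - f t - (u - t) *\<^sub>R f' t) - (f v - f t - (v - t) *\<^sub>R f' t)"
            using K uv False by (simp add: \<phi>_def algebra_simps)
          also have "norm \<dots> \<le> e' * norm (u - t) + e' * norm (v - t)"
            using uv False by (intro order_trans[OF norm_triangle_ineq4] add_mono r(3)) auto
          also have "\<dots> = e' * measure lborel K" using K uv by (simp add: algebra_simps)
          finally show ?thesis using False by simp
        qed
      qed
      also have "\<dots> = e' * (b - a) + (\<Sum>(t, K)\<in>q. norm (f (Sup K) - f (Inf K)))"
      proof -
        have "(\<Sum>(t, K)\<in>p. e' * measure lborel K) = e' * (b - a)"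
          using additive_content_tagged_division[OF p] \<open>a \<le> b\<close>
          by (simp add: case_prod_unfold flip: sum_distrib_left)
        moreover have "(\<Sum>(t, K)\<in>p. if t \<in> N then norm (f (Sup K) - f (Inf K)) else 0)
            = (\<Sum>(t, K)\<in>q. norm (f (Sup K) - f (Inf K)))"
          using fin unfolding q_def by (simp add: sum.inter_filter case_prod_unfold)
        ultimately show ?thesis by (simp add: sum.distrib case_prod_unfold)
      qed
      also have "\<dots> < e" using bad e' by linarith
      finally show "norm ((\<Sum>(t, K)\<in>p. measure lborel K *\<^sub>R \<phi> t) - (f b - f a)) < e" .
    qed
  qed
  then show ?thesis
    using has_integral_spike[OF N, of "{a..b}" f' \<phi>] by (simp add: \<phi>_def)
qed

text \<open>By the previous lemma \<open>f\<close> is a constant plus the integral of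
  \<open>F\<close>, and the integral of a continuous function is differentiable at every point, not
  just almost everywhere.\<close>

lemma has_vector_derivative_absolutely_continuous:
  fixes f :: "real \<Rightarrow> 'a::banach"
  assumes ac: "locally_absolutely_continuous_from a f"
    and deriv: "AE t in lebesgue. a \<le> t \<longrightarrow> (f has_vector_derivative F t) (at t within {a..})"
    and cont: "continuous_on {a..} F" and "a < t"
  shows "(f has_vector_derivative F t) (at t)"
proof -
  obtain N where N: "negligible N"
    "\<And>s. s \<notin> N \<Longrightarrow> a \<le> s \<Longrightarrow> (f has_vector_derivative F s) (at s within {a..})"
    using deriv by (auto elim!: AE_E3 simp: negligible_iff_null_sets)
  have int: "(F has_integral (f s - f a)) {a..s}" if "a < s" for s
    using that ac unfolding locally_absolutely_continuous_from_def
    by (intro fundamental_theorem_of_calculus_absolutely_continuous[OF _ _ N(1)])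
      (auto intro: has_vector_derivative_within_subset[OF N(2)])
  \<comment> \<open>The right end \<open>t+1\<close> makes \<open>t\<close> an interior point, so
    that the derivative becomes two-sided.\<close>
  have "((\<lambda>s. integral {a..s} F) has_vector_derivative F t) (at t within {a..t+1})"
    using \<open>a < t\<close> by (intro integral_has_vector_derivative continuous_on_subset[OF cont]) auto
  then have "((\<lambda>s. integral {a..s} F) has_vector_derivative F t) (at t)"
    using \<open>a < t\<close> by (simp add: at_within_Icc_at)
  then have "((\<lambda>s. f a + integral {a..s} F) has_vector_derivative F t) (at t)"
    by (auto intro!: derivative_eq_intros)
  then show ?thesis
  proof (rule has_vector_derivative_transform_within_open[where S = "{a<..}"])
    show "f a + integral {a..s} F = f s" if "s \<in> {a<..}" for s
      using int[of s] that by (simp add: integral_unique)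
  qed (use \<open>a < t\<close> in auto)
qed

lemma locally_absolutely_continuous_from_imp_continuous_on:
  assumes "locally_absolutely_continuous_from a f"
  shows "continuous_on {a..} f"
  unfolding continuous_on_iff
proof (intro ballI allI impI)
  fix s e :: real assume s: "s \<in> {a..}" and e: "e > 0"
  then have "absolutely_continuous_on {a..s+1} f"
    using assms by (auto simp: locally_absolutely_continuous_from_def)
  then obtain \<delta> where \<delta>: "\<delta> > 0" and
    small: "\<And>D T. D division_of T \<Longrightarrow> T \<subseteq> {a..s+1} \<Longrightarrow> (\<Sum>K\<in>D. measure lborel K) < \<delta> \<Longrightarrow>
      (\<Sum>K\<in>D. norm (f (Sup K) - f (Inf K))) < e"
    using e unfolding absolutely_continuous_on_def by meson
  \<comment> \<open>Absolute continuity is applied to a division with a single member.\<close>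
  have close: "norm (f w - f u) < e" if "a \<le> u" "u \<le> w" "w \<le> s + 1" "w - u < \<delta>" for u w
    using small[of "{{u..w}}" "{u..w}"] that division_of_self[of u w] by simp
  show "\<exists>d>0. \<forall>t\<in>{a..}. dist t s < d \<longrightarrow> dist (f t) (f s) < e"
  \<comment> \<open>The bound 1 keeps \<open>t\<close> inside \<open>{a..s+1}\<close>.\<close>
  proof (intro exI[of _ "min \<delta> 1"] conjI ballI impI)
    fix t assume t: "t \<in> {a..}" "dist t s < min \<delta> 1"
    show "dist (f t) (f s) < e"
    proof (cases "t \<le> s")
      case True
      then show ?thesis using close[of t s] t s by (simp add: dist_norm norm_minus_commute)
    next
      case False
      then show ?thesis using close[of s t] t s by (simp add: dist_norm)
    qed
  qed (use \<delta> in auto)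
qed

section \<open>Derivatives along curves and the tangent inequality\<close>

lemma has_real_derivative_inner:
  assumes "(f has_vector_derivative f') (at t within S)"
    and "(h has_vector_derivative h') (at t within S)"
  shows "((\<lambda>t. f t \<bullet> h t) has_real_derivative f t \<bullet> h' + f' \<bullet> h t) (at t within S)"
  unfolding has_real_derivative_iff_has_vector_derivative
  by (rule bounded_bilinear.has_vector_derivative[OF bounded_bilinear_inner assms])

lemma GDERIV_compose_has_real_derivative:
  assumes "GDERIV g (y t) :> d" and "(y has_vector_derivative y') (at t)"
  shows "((\<lambda>s. g (y s)) has_real_derivative y' \<bullet> d) (at t)"
proof -
  have "((\<lambda>s. g (y s)) has_derivative (\<lambda>s. (s *\<^sub>R y') \<bullet> d)) (at t)"
    using assms unfolding gderiv_def has_vector_derivative_def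
    by (rule has_derivative_compose[rotated])
  then show ?thesis
    by (simp add: has_field_derivative_def mult_commute_abs)
qed

text \<open>Restricting \<open>g\<close> to the line through \<open>y\<close> and \<open>z\<close>
  reduces this to the tangent inequality for convex functions of one real variable.\<close>

lemma convex_on_GDERIV_above_tangent:
  assumes "convex_on UNIV g" and "GDERIV g y :> d"
  shows "g y + (z - y) \<bullet> d \<le> g z"
proof -
  define \<phi> where "\<phi> s = g (y + s *\<^sub>R (z - y))" for s :: real
  have "convex_on UNIV \<phi>"
  proof (rule convex_onI)
    fix t a b :: real assume t: "0 < t" "t < 1"
    have "y + ((1 - t) *\<^sub>R a + t *\<^sub>R b) *\<^sub>R (z - y)
        = (1 - t) *\<^sub>R (y + a *\<^sub>R (z - y)) + t *\<^sub>R (y + b *\<^sub>R (z - y))"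
      by (simp add: algebra_simps)
    then show "\<phi> ((1 - t) *\<^sub>R a + t *\<^sub>R b) \<le> (1 - t) * \<phi> a + t * \<phi> b"
      unfolding \<phi>_def using convex_onD[OF assms(1)] t by simp
  qed simp
  moreover have "(\<phi> has_real_derivative (z - y) \<bullet> d) (at 0)"
    unfolding \<phi>_def
    by (rule GDERIV_compose_has_real_derivative)
      (use assms(2) in \<open>auto intro!: derivative_eq_intros\<close>)
  ultimately have "(z - y) \<bullet> d * (1 - 0) \<le> \<phi> 1 - \<phi> 0"
    by (intro convex_on_imp_above_tangent[of UNIV]) auto
  then show ?thesis by (simp add: \<phi>_def)
qed

section \<open>Limits at infinity and a weighted Cauchy-Schwarz inequality\<close>

lemma tendsto_at_top_if_deriv_nonpos:
  fixes f :: "real \<Rightarrow> real"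
  assumes deriv: "\<And>t. t \<ge> T \<Longrightarrow> \<exists>D. (f has_real_derivative D) (at t) \<and> D \<le> 0"
    and bdd: "\<And>t. t \<ge> T \<Longrightarrow> f t \<ge> c"
  obtains l where "(f \<longlongrightarrow> l) at_top"
proof
  have mono: "f t \<le> f s" if "T \<le> s" "s \<le> t" for s t
    using that deriv by (intro DERIV_nonpos_imp_nonincreasing[of s t f]) auto
  have bd: "bdd_below (f ` {T..})" using bdd by (auto intro!: bdd_belowI)
  show "(f \<longlongrightarrow> Inf (f ` {T..})) at_top"
  proof (rule decreasing_tendsto)
    show "\<forall>\<^sub>F t in at_top. Inf (f ` {T..}) \<le> f t"
      using eventually_ge_at_top[of T] by eventually_elim (auto intro: cInf_lower bd)
    fix u assume "Inf (f ` {T..}) < u"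
    then obtain s where "s \<ge> T" "f s < u"
      using cInf_less_iff[of "f ` {T..}" u] bd by auto
    show "\<forall>\<^sub>F t in at_top. f t < u"
      using eventually_ge_at_top[of s]
    proof eventually_elim
      case (elim t)
      then show ?case using mono[of s t] \<open>s \<ge> T\<close> \<open>f s < u\<close> by linarith
    qed
  qed
qed

text \<open>L'Hospital's rule applied to \<open>t\<^sup>r h(t) / t\<^sup>r\<close>.\<close>

lemma tendsto_if_Euler_operator_tendsto:
  fixes h :: "real \<Rightarrow> real"
  assumes "r > 0" and deriv: "\<forall>\<^sub>F t in at_top. (h has_real_derivative h' t) (at t)"
    and lim: "((\<lambda>t. r * h t + t * h' t) \<longlongrightarrow> l) at_top"
  shows "(h \<longlongrightarrow> l / r) at_top"
proof -
  have "((\<lambda>t. (t powr r * h t) / t powr r) \<longlongrightarrow> l / r) at_top"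
  proof (rule lhospital_at_top_at_top)
    show "LIM t at_top. t powr r :> at_top" using \<open>r > 0\<close> by real_asymp
    show "\<forall>\<^sub>F t in at_top. r * t powr (r - 1) \<noteq> 0"
      using eventually_gt_at_top[of 0] \<open>r > 0\<close> by (auto elim!: eventually_mono)
    show "\<forall>\<^sub>F t in at_top. ((\<lambda>t. t powr r) has_real_derivative r * t powr (r - 1)) (at t)"
      using eventually_gt_at_top[of 0] by eventually_elim (auto intro!: derivative_eq_intros)
    show "\<forall>\<^sub>F t in at_top. ((\<lambda>t. t powr r * h t) has_real_derivative
        r * t powr (r - 1) * h t + t powr r * h' t) (at t)"
      using eventually_gt_at_top[of 0] deriv
      by eventually_elim (auto intro!: derivative_eq_intros)
    have "((\<lambda>t. (r * h t + t * h' t) / r) \<longlongrightarrow> l / r) at_top"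
      using lim \<open>r > 0\<close> by (intro tendsto_intros) auto
    then show "((\<lambda>t. (r * t powr (r - 1) * h t + t powr r * h' t) / (r * t powr (r - 1)))
        \<longlongrightarrow> l / r) at_top"
    proof (rule Lim_transform_eventually)
      show "\<forall>\<^sub>F t in at_top. (r * h t + t * h' t) / r =
          (r * t powr (r - 1) * h t + t powr r * h' t) / (r * t powr (r - 1))"
        using eventually_gt_at_top[of 0]
      proof eventually_elim
        case (elim t)
        have "t powr r = t * t powr (r - 1)"
          using elim by (simp add: powr_diff)
        then show ?case using elim \<open>r > 0\<close> by (simp add: field_simps)
      qed
    qed
  qed
  moreover have "\<forall>\<^sub>F t in at_top. t powr r * h t / t powr r = h t"
    using eventually_gt_at_top[of 0] by eventually_elim simp
  ultimately show ?thesis by (rule Lim_transform_eventually)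
qed

text \<open>Cauchy-Schwarz followed by the inequality of arithmetic and geometric means. It serves
  to absorb the mixed term in the derivative of the energy.\<close>

lemma mult_inner_le_weighted:
  assumes "k\<^sup>2 \<le> 4 * A * B" "A \<ge> 0" "B \<ge> 0"
  shows "k * (v \<bullet> w) \<le> A * (v \<bullet> v) + B * (w \<bullet> w)"
proof (rule power2_le_imp_le)
  have "(k * (v \<bullet> w))\<^sup>2 \<le> (4 * A * B) * ((v \<bullet> v) * (w \<bullet> w))"
    unfolding power_mult_distrib
    using assms by (intro mult_mono Cauchy_Schwarz_ineq) auto
  also have "\<dots> \<le> (A * (v \<bullet> v) + B * (w \<bullet> w))\<^sup>2"
    using zero_le_power2[of "A * (v \<bullet> v) - B * (w \<bullet> w)"]
    by (simp add: power2_eq_square algebra_simps)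
  finally show "(k * (v \<bullet> w))\<^sup>2 \<le> (A * (v \<bullet> v) + B * (w \<bullet> w))\<^sup>2" .
qed (use assms in auto)

section \<open>The energy along a classical solution\<close>

locale inertial_flow =
  fixes g :: "'a::euclidean_space \<Rightarrow> real" and grad :: "'a \<Rightarrow> 'a"
    and x v :: "real \<Rightarrow> 'a" and t0 \<alpha> \<beta> \<gamma> :: real
  assumes convex: "convex_on UNIV g"
    and grad: "\<And>y. GDERIV g y :> grad y"
    and deriv_x: "\<And>t. t > t0 \<Longrightarrow> (x has_vector_derivative v t) (at t)"
    and deriv_v: "\<And>t. t > t0 \<Longrightarrow> (v has_vector_derivative
      - (\<alpha> / t) *\<^sub>R v t - grad (x t + (\<gamma> + \<beta> / t) *\<^sub>R v t)) (at t)"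
    and t0: "t0 > 0" and \<alpha>: "\<alpha> > 3" and \<gamma>: "\<gamma> > 0"
begin

definition y :: "real \<Rightarrow> 'a" where
  "y t = x t + (\<gamma> + \<beta> / t) *\<^sub>R v t"

text \<open>This expanded form is affine in \<open>b\<close>, so energies for different
  \<open>b\<close> can be subtracted easily. Nonnegativity is visible only in the form
  \<open>energy_eq\<close>.\<close>

definition energy :: "real \<Rightarrow> 'a \<Rightarrow> real \<Rightarrow> real" where
  "energy b p t = t\<^sup>2 * (g (y t) - g p) + t\<^sup>2 * (v t \<bullet> v t) / 2
     + b * ((\<alpha> - 1) * ((x t - p) \<bullet> (x t - p)) / 2 + t * ((x t - p) \<bullet> v t))"

text \<open>Completing the square in \<open>b *\<^sub>R (x t - p) + t *\<^sub>R v t\<close> leaves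
  the last term.\<close>

lemma energy_eq:
  "energy b p t = t\<^sup>2 * (g (y t) - g p) + (norm (b *\<^sub>R (x t - p) + t *\<^sub>R v t))\<^sup>2 / 2
     + b * (\<alpha> - 1 - b) * (norm (x t - p))\<^sup>2 / 2"
proof -
  have sq: "(b *\<^sub>R u + t *\<^sub>R w) \<bullet> (b *\<^sub>R u + t *\<^sub>R w)
      = b\<^sup>2 * (u \<bullet> u) + 2 * b * t * (u \<bullet> w) + t\<^sup>2 * (w \<bullet> w)" for u w :: 'a
    by (simp add: inner_add_left inner_add_right inner_commute power2_eq_square)
  show ?thesis
    unfolding energy_def power2_norm_eq_inner sq by (simp add: power2_eq_square field_simps)
qed

text \<open>Two cancellations shape the result. The weight \<open>\<alpha> - 1\<close> removes the
  products of \<open>x t - p\<close> with \<open>v t\<close>, and the kinetic term removes the part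
  of order \<open>t\<^sup>2\<close> in the coefficient of
  \<open>v t \<bullet> grad (y t)\<close>.\<close>

lemma deriv_energy:
  assumes "t > t0"
  shows "(energy b p has_real_derivative
      2 * t * (g (y t) - g p) - b * t * ((y t - p) \<bullet> grad (y t))
      + ((b - \<alpha>) * (\<gamma> * t + \<beta>) - \<beta>) * (v t \<bullet> grad (y t))
      - t\<^sup>2 * (\<gamma> + \<beta> / t) * (grad (y t) \<bullet> grad (y t)) - (\<alpha> - 1 - b) * t * (v t \<bullet> v t)) (at t)"
proof -
  have t: "t > 0" using assms t0 by simp
  \<comment> \<open>\<open>w\<close> is the acceleration of \<open>x\<close>; \<open>z\<close> below
    is the velocity of \<open>y\<close>.\<close>
  define w where "w = - (\<alpha> / t) *\<^sub>R v t - grad (y t)"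
  note dx = deriv_x[OF assms] and dv = deriv_v[OF assms, folded y_def, folded w_def]
  define z where "z = v t + ((\<gamma> + \<beta> / t) *\<^sub>R w - (\<beta> / t\<^sup>2) *\<^sub>R v t)"
  have dy: "(y has_vector_derivative z) (at t)"
    unfolding y_def[abs_def] z_def
    by (rule derivative_eq_intros dx dv refl | use t in \<open>simp add: power2_eq_square\<close>)+
  have dgy: "((\<lambda>s. g (y s)) has_real_derivative z \<bullet> grad (y t)) (at t)"
    by (rule GDERIV_compose_has_real_derivative[OF grad dy])
  have dxp: "((\<lambda>s. x s - p) has_vector_derivative v t) (at t)"
    using dx by (auto intro!: derivative_eq_intros)
  note di = has_real_derivative_inner[OF dv dv] has_real_derivative_inner[OF dxp dxp]
    has_real_derivative_inner[OF dxp dv]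
  have z_inner: "t\<^sup>2 * (z \<bullet> grad (y t)) = (t\<^sup>2 - \<beta> - \<alpha> * (\<gamma> * t + \<beta>)) * (v t \<bullet> grad (y t))
      - t\<^sup>2 * (\<gamma> + \<beta> / t) * (grad (y t) \<bullet> grad (y t))"
    unfolding z_def w_def using t
    by (simp add: inner_add_left inner_diff_left field_simps power2_eq_square)
  have w_inner: "t * (w \<bullet> u) = - \<alpha> * (v t \<bullet> u) - t * (grad (y t) \<bullet> u)" for u
    unfolding w_def using t by (simp add: inner_diff_left field_simps)
  \<comment> \<open>The gradient is taken at \<open>y t\<close>, so convexity will apply to
    \<open>y t - p\<close>; the exchange for \<open>x t - p\<close> feeds the mixed term.\<close>
  have yp: "t * ((y t - p) \<bullet> grad (y t)) =
      t * ((x t - p) \<bullet> grad (y t)) + (\<gamma> * t + \<beta>) * (v t \<bullet> grad (y t))"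
    unfolding y_def using t by (simp add: inner_add_left inner_diff_left field_simps)
  have dsq: "((\<lambda>s. s\<^sup>2) has_real_derivative 2 * t) (at t)"
    by (auto intro!: derivative_eq_intros)
  have "(energy b p has_real_derivative
      2 * t * (g (y t) - g p) + t\<^sup>2 * (z \<bullet> grad (y t)) + t * (v t \<bullet> v t) + t * (t * (w \<bullet> v t))
      + b * ((\<alpha> - 1) * ((x t - p) \<bullet> v t) + (x t - p) \<bullet> v t + t * (v t \<bullet> v t) + t * (w \<bullet> (x t - p))))
      (at t)"
    unfolding energy_def[abs_def]
    by (rule DERIV_cong, rule DERIV_add[OF
          DERIV_add[OF DERIV_mult[OF dsq DERIV_diff[OF dgy DERIV_const]]
            DERIV_cdivide[OF DERIV_mult[OF dsq di(1)]]]
          DERIV_cmult[OF DERIV_add[OF DERIV_cdivide[OF DERIV_cmult[OF di(2)]]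
            DERIV_mult[OF DERIV_ident di(3)]]]])
      (simp add: inner_commute power2_eq_square field_simps)
  then show ?thesis
  proof (rule DERIV_cong)
    show "2 * t * (g (y t) - g p) + t\<^sup>2 * (z \<bullet> grad (y t)) + t * (v t \<bullet> v t) + t * (t * (w \<bullet> v t))
        + b * ((\<alpha> - 1) * ((x t - p) \<bullet> v t) + (x t - p) \<bullet> v t + t * (v t \<bullet> v t) + t * (w \<bullet> (x t - p)))
      = 2 * t * (g (y t) - g p) - b * t * ((y t - p) \<bullet> grad (y t))
      + ((b - \<alpha>) * (\<gamma> * t + \<beta>) - \<beta>) * (v t \<bullet> grad (y t))
      - t\<^sup>2 * (\<gamma> + \<beta> / t) * (grad (y t) \<bullet> grad (y t)) - (\<alpha> - 1 - b) * t * (v t \<bullet> v t)"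
      unfolding z_inner w_inner mult.assoc[of b] yp
      unfolding inner_commute[of "v t" "x t - p"] inner_commute[of "grad (y t)" "x t - p"]
        inner_commute[of "grad (y t)" "v t"]
      by (simp add: power2_eq_square algebra_simps)
  qed
qed

text \<open>The bound \<open>2 < b\<close> lets convexity absorb the gap term
  \<open>2 * t * (g (y t) - g p)\<close>, and \<open>b < \<alpha> - 1\<close> gives the velocity
  term its negative sign. Both make the energy eventually nonincreasing.\<close>

lemma energy_tendsto:
  assumes p: "p \<in> argmin g" and b: "2 < b" "b < \<alpha> - 1"
  obtains l where "(energy b p \<longlongrightarrow> l) at_top"
proof -
  define c where "c = \<alpha> - 1 - b"
  have c: "c > 0" using b by (simp add: c_def)
  have min: "g p \<le> g z" for z using p by (simp add: is_arg_min_linorder)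
  \<comment> \<open>the discriminant condition that lets the quadratic terms absorb the mixed one\<close>
  have "\<forall>\<^sub>F t in at_top. ((b - \<alpha>) * (\<gamma> * t + \<beta>) - \<beta>)\<^sup>2 \<le> 4 * (c * t) * (t\<^sup>2 * (\<gamma> + \<beta> / t))
      \<and> t\<^sup>2 * (\<gamma> + \<beta> / t) \<ge> 0"
    (is "\<forall>\<^sub>F t in at_top. ?Q t")
  proof -
    \<comment> \<open>The left side of the condition is quadratic in \<open>t\<close> and the right
      side cubic with leading coefficient \<open>4 * c * \<gamma> > 0\<close>, hence the division by
      \<open>t ^ 3\<close>.\<close>
    have "((\<lambda>t. 4 * c * (\<gamma> + \<beta> / t) - ((b - \<alpha>) * (\<gamma> * t + \<beta>) - \<beta>)\<^sup>2 / t ^ 3)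
        \<longlongrightarrow> 4 * c * (\<gamma> + 0) - 0) at_top"
    proof (intro tendsto_intros)
      show "((\<lambda>t. \<beta> / t) \<longlongrightarrow> 0) at_top" by real_asymp
      show "((\<lambda>t. ((b - \<alpha>) * (\<gamma> * t + \<beta>) - \<beta>)\<^sup>2 / t ^ 3) \<longlongrightarrow> 0) at_top"
      proof (rule Lim_transform_eventually)
        have "((\<lambda>t. \<beta> / t) \<longlongrightarrow> 0) at_top" "((\<lambda>t. 1 / t :: real) \<longlongrightarrow> 0) at_top"
          by real_asymp+
        then have "((\<lambda>t. ((b - \<alpha>) * (\<gamma> + \<beta> / t) - \<beta> / t)\<^sup>2 * (1 / t))
            \<longlongrightarrow> ((b - \<alpha>) * (\<gamma> + 0) - 0)\<^sup>2 * 0) at_top"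
          by (intro tendsto_intros)
        then show "((\<lambda>t. ((b - \<alpha>) * (\<gamma> + \<beta> / t) - \<beta> / t)\<^sup>2 * (1 / t)) \<longlongrightarrow> 0) at_top"
          by simp
        show "\<forall>\<^sub>F t in at_top. ((b - \<alpha>) * (\<gamma> + \<beta> / t) - \<beta> / t)\<^sup>2 * (1 / t)
            = ((b - \<alpha>) * (\<gamma> * t + \<beta>) - \<beta>)\<^sup>2 / t ^ 3"
          using eventually_gt_at_top[of 0]
          by eventually_elim (simp add: power2_eq_square power3_eq_cube field_simps)
      qed
    qed
    then have "\<forall>\<^sub>F t in at_top. 0 < 4 * c * (\<gamma> + \<beta> / t)
        - ((b - \<alpha>) * (\<gamma> * t + \<beta>) - \<beta>)\<^sup>2 / t ^ 3"
      by (rule order_tendstoD(1)) (use c \<gamma> in simp)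
    then show ?thesis
      using eventually_gt_at_top[of 0]
    proof eventually_elim
      case (elim t)
      have "0 \<le> ((b - \<alpha>) * (\<gamma> * t + \<beta>) - \<beta>)\<^sup>2 / t ^ 3" using elim by simp
      \<comment> \<open>Since \<open>\<beta>\<close> may be negative, the sign of
        \<open>\<gamma> + \<beta> / t\<close> is read off from the same estimate.\<close>
      then have "0 < 4 * c * (\<gamma> + \<beta> / t)" using elim by linarith
      then have "0 < \<gamma> + \<beta> / t" using c by (simp add: zero_less_mult_iff)
      then have "0 \<le> t\<^sup>2 * (\<gamma> + \<beta> / t)" by simp
      moreover have "((b - \<alpha>) * (\<gamma> * t + \<beta>) - \<beta>)\<^sup>2 \<le> 4 * c * (\<gamma> + \<beta> / t) * t ^ 3"
        using elim by (simp add: pos_divide_le_eq[symmetric])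
      moreover have "4 * c * (\<gamma> + \<beta> / t) * t ^ 3 = 4 * (c * t) * (t\<^sup>2 * (\<gamma> + \<beta> / t))"
        by (simp add: power2_eq_square power3_eq_cube)
      ultimately show ?case by simp
    qed
  qed
  then obtain T where T: "\<And>t. t \<ge> T \<Longrightarrow> ?Q t"
    unfolding eventually_at_top_linorder by blast
  show thesis
  proof (rule tendsto_at_top_if_deriv_nonpos[where T = "max T (t0 + 1)" and c = 0])
    fix t assume t: "t \<ge> max T (t0 + 1)"
    then have "t > t0" "t > 0" using t0 by auto
    have "g (y t) + (p - y t) \<bullet> grad (y t) \<le> g p"
      by (rule convex_on_GDERIV_above_tangent[OF convex grad])
    then have "(y t - p) \<bullet> grad (y t) \<ge> g (y t) - g p"
      by (simp add: inner_diff_left)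
    then have "b * t * ((y t - p) \<bullet> grad (y t)) \<ge> 2 * t * (g (y t) - g p)"
      using b \<open>t > 0\<close> min[of "y t"] by (intro mult_mono) auto
    moreover have "((b - \<alpha>) * (\<gamma> * t + \<beta>) - \<beta>) * (v t \<bullet> grad (y t))
        \<le> c * t * (v t \<bullet> v t) + t\<^sup>2 * (\<gamma> + \<beta> / t) * (grad (y t) \<bullet> grad (y t))"
      using T[of t] t c \<open>t > 0\<close> by (intro mult_inner_le_weighted) auto
    ultimately show "\<exists>D. (energy b p has_real_derivative D) (at t) \<and> D \<le> 0"
      using deriv_energy[OF \<open>t > t0\<close>, of b p] by (intro exI conjI) (auto simp: c_def)
  next
    fix t show "energy b p t \<ge> 0"
      unfolding energy_eq using b min[of "y t"] by simp
  qed (fact that)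
qed

section \<open>Distance to minimisers and decay rates\<close>

text \<open>The slope of the energy in \<open>b\<close> is
  \<open>(\<alpha> - 1) * h + t * h'\<close>, where \<open>h\<close> is half the squared distance;
  it converges as a difference quotient of two convergent energies.\<close>

lemma dist_argmin_tendsto:
  assumes p: "p \<in> argmin g"
  obtains l where "((\<lambda>t. (norm (x t - p))\<^sup>2) \<longlongrightarrow> l) at_top"
proof -
  \<comment> \<open>\<open>b1\<close> and \<open>b2\<close> cut the interval from 2 to
    \<open>\<alpha> - 1\<close> into thirds; it is nondegenerate because
    \<open>\<alpha> > 3\<close>.\<close>
  define b1 where "b1 = 2 + (\<alpha> - 3) / 3"
  define b2 where "b2 = 2 + 2 * (\<alpha> - 3) / 3"
  have b: "2 < b1" "b1 < \<alpha> - 1" "2 < b2" "b2 < \<alpha> - 1" "b1 \<noteq> b2"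
    using \<alpha> by (auto simp: b1_def b2_def field_simps)
  obtain l1 where "(energy b1 p \<longlongrightarrow> l1) at_top" using energy_tendsto[OF p b(1,2)] .
  moreover obtain l2 where "(energy b2 p \<longlongrightarrow> l2) at_top" using energy_tendsto[OF p b(3,4)] .
  ultimately have "((\<lambda>t. (energy b2 p t - energy b1 p t) / (b2 - b1))
      \<longlongrightarrow> (l2 - l1) / (b2 - b1)) at_top"
    using b by (intro tendsto_divide tendsto_diff tendsto_const) auto
  moreover have "(energy b2 p t - energy b1 p t) / (b2 - b1)
      = (\<alpha> - 1) * ((x t - p) \<bullet> (x t - p) / 2) + t * ((x t - p) \<bullet> v t)" for t
  proof -
    have "energy b2 p t - energy b1 p t
        = (b2 - b1) * ((\<alpha> - 1) * ((x t - p) \<bullet> (x t - p) / 2) + t * ((x t - p) \<bullet> v t))"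
      by (simp add: energy_def flip: left_diff_distrib)
    then show ?thesis using b by simp
  qed
  ultimately have lim: "((\<lambda>t. (\<alpha> - 1) * ((x t - p) \<bullet> (x t - p) / 2) + t * ((x t - p) \<bullet> v t))
      \<longlongrightarrow> (l2 - l1) / (b2 - b1)) at_top"
    by simp
  have "\<forall>\<^sub>F t in at_top. ((\<lambda>t. (x t - p) \<bullet> (x t - p) / 2) has_real_derivative (x t - p) \<bullet> v t) (at t)"
    using eventually_gt_at_top[of t0]
  proof eventually_elim
    case (elim t)
    have "((\<lambda>s. x s - p) has_vector_derivative v t) (at t)"
      using deriv_x[OF elim] by (auto intro!: derivative_eq_intros)
    from DERIV_cdivide[OF has_real_derivative_inner[OF this this], of 2] show ?case
      by (rule DERIV_cong) (simp add: inner_commute[of "v t"])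
  qed
  from tendsto_if_Euler_operator_tendsto[OF _ this lim]
  have "((\<lambda>t. (x t - p) \<bullet> (x t - p) / 2) \<longlongrightarrow> (l2 - l1) / (b2 - b1) / (\<alpha> - 1)) at_top"
    using \<alpha> by simp
  from tendsto_mult[OF tendsto_const[of 2] this] show thesis
    by (intro that) (simp add: power2_norm_eq_inner)
qed

text \<open>Each summand of \<open>energy_eq\<close> is nonnegative, so each is bounded once the
  energy is. Since \<open>x t - p\<close> is bounded too, the square term then bounds
  \<open>t *\<^sub>R v t\<close>.\<close>

lemma energy_bounds:
  assumes p: "p \<in> argmin g"
  obtains M R where "\<forall>\<^sub>F t in at_top. norm (x t) \<le> R"
    and "\<forall>\<^sub>F t in at_top. norm (v t) \<le> R / t"
    and "\<forall>\<^sub>F t in at_top. g (y t) - g p \<le> M / t\<^sup>2"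
proof -
  \<comment> \<open>The midpoint of the admissible interval.\<close>
  define b where "b = 2 + (\<alpha> - 3) / 2"
  have b: "2 < b" "b < \<alpha> - 1" using \<alpha> by (auto simp: b_def field_simps)
  have min: "g p \<le> g z" for z using p by (simp add: is_arg_min_linorder)
  obtain l where "(energy b p \<longlongrightarrow> l) at_top" using energy_tendsto[OF p b] .
  then have ev: "\<forall>\<^sub>F t in at_top. energy b p t < l + 1"
    by (intro order_tendstoD) auto
  obtain m where "((\<lambda>t. (norm (x t - p))\<^sup>2) \<longlongrightarrow> m) at_top" using dist_argmin_tendsto[OF p] .
  then have evx: "\<forall>\<^sub>F t in at_top. (norm (x t - p))\<^sup>2 < m + 1"
    by (intro order_tendstoD) auto
  define R1 where "R1 = sqrt (m + 1)"
  define R2 where "R2 = sqrt (2 * (l + 1))"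
  have bd1: "norm (x t - p) \<le> R1" if "(norm (x t - p))\<^sup>2 < m + 1" for t
    using that by (simp add: R1_def real_le_rsqrt)
  have parts: "t\<^sup>2 * (g (y t) - g p) \<le> l + 1" "norm (b *\<^sub>R (x t - p) + t *\<^sub>R v t) \<le> R2"
    if "energy b p t < l + 1" for t
  proof -
    have nn: "0 \<le> t\<^sup>2 * (g (y t) - g p)" "0 \<le> b * (\<alpha> - 1 - b) * (norm (x t - p))\<^sup>2 / 2"
      using min[of "y t"] b by auto
    show "t\<^sup>2 * (g (y t) - g p) \<le> l + 1"
      using that nn zero_le_power2[of "norm (b *\<^sub>R (x t - p) + t *\<^sub>R v t)"] unfolding energy_eq
      by linarith
    have "B \<le> 2 * (l + 1)" if "A + B / 2 + C < l + 1" "0 \<le> A" "0 \<le> C" for A B C :: real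
      using that by (simp add: field_simps)
    then have "(norm (b *\<^sub>R (x t - p) + t *\<^sub>R v t))\<^sup>2 \<le> 2 * (l + 1)"
      using that[unfolded energy_eq] nn by blast
    then show "norm (b *\<^sub>R (x t - p) + t *\<^sub>R v t) \<le> R2"
      by (simp add: R2_def real_le_rsqrt)
  qed
  show thesis
  proof (rule that[of "max (R1 + norm p) (R2 + b * R1)" "l + 1"])
    show "\<forall>\<^sub>F t in at_top. norm (x t) \<le> max (R1 + norm p) (R2 + b * R1)"
      using evx
    proof eventually_elim
      case (elim t)
      then show ?case using bd1[of t] norm_triangle_ineq2[of "x t" p] by linarith
    qed
    show "\<forall>\<^sub>F t in at_top. norm (v t) \<le> max (R1 + norm p) (R2 + b * R1) / t"
      using evx ev eventually_gt_at_top[of 0]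
    proof eventually_elim
      case (elim t)
      have "t * norm (v t) = norm ((b *\<^sub>R (x t - p) + t *\<^sub>R v t) - b *\<^sub>R (x t - p))"
        using elim by simp
      also have "\<dots> \<le> R2 + b * R1"
        using parts(2)[OF elim(2)] bd1[OF elim(1)] b
        by (intro order_trans[OF norm_triangle_ineq4] add_mono) auto
      finally show ?case using elim(3) by (simp add: field_simps)
    qed
    show "\<forall>\<^sub>F t in at_top. g (y t) - g p \<le> (l + 1) / t\<^sup>2"
      using ev eventually_gt_at_top[of 0]
      by eventually_elim (use parts(1) in \<open>simp add: field_simps\<close>)
  qed
qed

section \<open>Opial's argument\<close>

theorem converges:
  assumes "argmin g \<noteq> {}"
  shows "\<exists>p \<in> argmin g. (x \<longlongrightarrow> p) at_top"
proof -
  obtain q where q: "q \<in> argmin g" using assms by auto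
  have min: "g q \<le> g z" for z using q by (simp add: is_arg_min_linorder)
  obtain M R where R: "\<forall>\<^sub>F t in at_top. norm (x t) \<le> R"
    and v_le: "\<forall>\<^sub>F t in at_top. norm (v t) \<le> R / t"
    and gap: "\<forall>\<^sub>F t in at_top. g (y t) - g q \<le> M / t\<^sup>2"
    using energy_bounds[OF q] .
  have v0: "(v \<longlongrightarrow> 0) at_top"
    by (rule Lim_null_comparison[OF v_le]) real_asymp
  have gy: "((\<lambda>t. g (y t)) \<longlongrightarrow> g q) at_top"
  proof -
    have "((\<lambda>t. g (y t) - g q) \<longlongrightarrow> 0) at_top"
    proof (rule tendsto_sandwich[where f = "\<lambda>_. 0"])
      show "((\<lambda>t. M / t\<^sup>2) \<longlongrightarrow> 0) at_top" by real_asymp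
    qed (use gap min in auto)
    then show ?thesis by (simp add: LIM_zero_iff)
  qed
  have y_x: "((\<lambda>t. y t - x t) \<longlongrightarrow> 0) at_top"
  proof -
    have "((\<lambda>t. \<gamma> + \<beta> / t) \<longlongrightarrow> \<gamma>) at_top" by real_asymp
    from tendsto_scaleR[OF this v0] show ?thesis by (simp add: y_def)
  qed
  obtain T where T: "\<And>t. t \<ge> T \<Longrightarrow> norm (x t) \<le> R"
    using R unfolding eventually_at_top_linorder by blast
  \<comment> \<open>Sampling starts at \<open>T\<close>, from where the norm bound holds.\<close>
  have "bounded (range (\<lambda>n. x (T + real n)))"
    using T by (intro boundedI[of _ R]) auto
  then obtain p r where r: "strict_mono r" and p: "(\<lambda>n. x (T + real (r n))) \<longlonglongrightarrow> p"
    using bounded_imp_convergent_subsequence unfolding o_def by blast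
  have top: "LIM n sequentially. T + real (r n) :> at_top"
    using filterlim_subseq[OF r]
    by (intro filterlim_tendsto_add_at_top[OF tendsto_const])
      (rule filterlim_compose[OF filterlim_real_sequentially])
  \<comment> \<open>The values of \<open>g\<close> are controlled along \<open>y\<close>, not
    \<open>x\<close>; as \<open>y t - x t\<close> tends to 0, both have the cluster point
    \<open>p\<close>.\<close>
  have "(\<lambda>n. y (T + real (r n))) \<longlonglongrightarrow> p"
    using tendsto_add[OF filterlim_compose[OF y_x top] p] by simp
  moreover have "isCont g p"
    using grad[of p] unfolding gderiv_def by (rule has_derivative_continuous)
  ultimately have "(\<lambda>n. g (y (T + real (r n)))) \<longlonglongrightarrow> g p"
    by (rule isCont_tendsto_compose[rotated])
  then have "g p = g q"
    using filterlim_compose[OF gy top] by (rule LIMSEQ_unique)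
  then have p_min: "p \<in> argmin g" using min by (simp add: is_arg_min_linorder)
  \<comment> \<open>The whole trajectory now has a limiting distance to \<open>p\<close>, and the
    subsequence forces it to be 0.\<close>
  obtain m where m: "((\<lambda>t. (norm (x t - p))\<^sup>2) \<longlongrightarrow> m) at_top"
    using dist_argmin_tendsto[OF p_min] .
  have norm_p: "(\<lambda>n. (norm (x (T + real (r n)) - p))\<^sup>2) \<longlonglongrightarrow> (norm (p - p))\<^sup>2"
    by (rule tendsto_power[OF tendsto_norm[OF tendsto_diff[OF p tendsto_const]]])
  have "m = 0"
    using LIMSEQ_unique[OF filterlim_compose[OF m top] norm_p] by simp
  then have "((\<lambda>t. sqrt ((norm (x t - p))\<^sup>2)) \<longlongrightarrow> sqrt 0) at_top"
    using tendsto_real_sqrt[OF m] by simp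
  then have "(x \<longlongrightarrow> p) at_top"
    by (simp add: tendsto_norm_zero_iff LIM_zero_iff)
  then show ?thesis using p_min by blast
qed

end

section \<open>From strong to classical solutions\<close>

theorem theorem27:
  fixes g :: "real ^ 'm \<Rightarrow> real" and grad :: "real ^ 'm \<Rightarrow> real ^ 'm"
    and u0 v0 :: "real ^ 'm" and x :: "real \<Rightarrow> real ^ 'm"
    and L t0 \<alpha> \<beta> \<gamma> :: real
  assumes "convex_on UNIV g"
    and "\<And>y. GDERIV g y :> grad y"
    and "L-lipschitz_on UNIV grad"
    and "argmin g \<noteq> {}"
    and "t0 > 0" and "\<alpha> > 3" and "\<gamma> > 0"
    and "strong_global_solution grad \<alpha> \<beta> \<gamma> t0 u0 v0 x"
  shows "\<exists>p \<in> argmin g. (x \<longlongrightarrow> p) at_top"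
proof -
  from assms(8) obtain v a where
    x: "\<forall>t\<ge>t0. (x has_vector_derivative v t) (at t within {t0..})"
    and v: "AE t in lebesgue. t0 \<le> t \<longrightarrow> (v has_vector_derivative a t) (at t within {t0..})"
    and ac: "locally_absolutely_continuous_from t0 v"
    and ode: "AE t in lebesgue. t0 \<le> t \<longrightarrow>
      a t + (\<alpha> / t) *\<^sub>R v t + grad (x t + (\<gamma> + \<beta> / t) *\<^sub>R v t) = 0"
    unfolding strong_global_solution_def by blast
  \<comment> \<open>\<open>F\<close> is the acceleration solved from the equation. It is continuous
    because \<open>x\<close>, \<open>v\<close> and the Lipschitz field \<open>grad\<close> are,
    which turns the almost everywhere derivative of \<open>v\<close> into a classical one on
    \<open>t > t0\<close>.\<close>
  define F where "F t = - (\<alpha> / t) *\<^sub>R v t - grad (x t + (\<gamma> + \<beta> / t) *\<^sub>R v t)" for t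
  have cont_v: "continuous_on {t0..} v"
    using ac by (rule locally_absolutely_continuous_from_imp_continuous_on)
  have cont_x: "continuous_on {t0..} x"
    using x by (auto intro: has_vector_derivative_continuous simp: continuous_on_eq_continuous_within)
  have "continuous_on {t0..} F"
    unfolding F_def using \<open>t0 > 0\<close>
    by (intro continuous_intros cont_x cont_v
        continuous_on_compose2[OF lipschitz_on_continuous_on[OF assms(3)]]) auto
  moreover have "AE t in lebesgue. t0 \<le> t \<longrightarrow> (v has_vector_derivative F t) (at t within {t0..})"
    using v ode
  proof eventually_elim
    case (elim t)
    show ?case
    proof
      assume "t0 \<le> t"
      then have "a t = F t"
        using elim(2) by (simp add: F_def algebra_simps eq_neg_iff_add_eq_0)
      then show "(v has_vector_derivative F t) (at t within {t0..})" using elim(1) \<open>t0 \<le> t\<close> by simp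
    qed
  qed
  ultimately have dv: "(v has_vector_derivative F t) (at t)" if "t > t0" for t
    using has_vector_derivative_absolutely_continuous[OF ac _ _ that] by blast
  interpret inertial_flow g grad x v t0 \<alpha> \<beta> \<gamma>
  proof
    show "(x has_vector_derivative v t) (at t)" if "t > t0" for t
    proof -
      have "at t within {t0..} = at t" using that by (intro at_within_interior) simp
      then show ?thesis using x that by (metis less_imp_le)
    qed
    show "(v has_vector_derivative - (\<alpha> / t) *\<^sub>R v t - grad (x t + (\<gamma> + \<beta> / t) *\<^sub>R v t)) (at t)"
      if "t > t0" for t
      using dv[OF that] by (simp add: F_def)
  qed (use assms in auto)
  show ?thesis using assms(4) by (rule converges)
qed

end
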